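(* Let $\kappa$ be a regular cardinal and let $\mathcal{T}$ be a countable complete first-order theory in a countable relational vocabulary $L$. Suppose that for every $\alpha<\kappa^+$ there are $\eta,\eta'\in\kappa^\kappa$ such that $M_\eta\models\mathcal{T}$, $M_{\eta'}\models\mathcal{T}$, $M_\eta\equiv^\alpha_{\kappa^+\kappa}M_{\eta'}$ and $M_\eta\not\cong M_{\eta'}$. Then the relation $\cong_{\mathcal{T}}\subseteq\kappa^\kappa\times\kappa^\kappa$ is not $\kappa$-Borel.
   Context: Coding of structures: $L=\{Q_m\mid m<\omega\}$ is a countable relational vocabulary and $\pi:\kappa^{<\omega}\to\kappa$ is a fixed bijection. For $\eta\in\kappa^\kappa$, $M_\eta$ is the $L$-structure with domain $\kappa$ in which, for $(a_1,\dots,a_n)\in\kappa^n$, $(a_1,\dots,a_n)\in Q_m^{M_\eta}$ iff $Q_m$ has arity $n$ and $\eta(\pi(m,a_1,\dots,a_n))>0$. The relation $\cong_{\mathcal{T}}$ is the set of pairs $(\eta,\xi)\in\kappa^\kappa\times\kappa^\kappa$ such that either ($M_\eta\models\mathcal{T}$, $M_\xi\models\mathcal{T}$ and $M_\eta\cong M_\xi$) or ($M_\eta\not\models\mathcal{T}$ and $M_\xi\not\models\mathcal{T}$). $M\equiv^\alpha_{\kappa^+\kappa}N$ means $M$ and $N$ satisfy the same $L_{\kappa^+\kappa}$-sentences of quantifier rank at most $\alpha$. Topology: for $X\subseteq\kappa$ with $|X|<\kappa$ and $\eta:X\to\kappa$, let $N_\eta=\{\zeta\in\kappa^\kappa\mid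 \eta\subseteq\zeta\}$; these sets together with $\emptyset$ are the basic $\kappa$-open subsets of $\kappa^\kappa$, and the basic $\kappa$-open subsets of $\kappa^\kappa\times\kappa^\kappa$ are the products $N_\eta\times N_\xi$ of basic $\kappa$-open sets. The $\kappa$-Borel sets (of $\kappa^\kappa$, resp. $\kappa^\kappa\times\kappa^\kappa$) form the smallest class containing the basic $\kappa$-open sets and closed under complements, unions of at most $\kappa$ sets and intersections of at most $\kappa$ sets. *)

theory Defs
  imports Main "HOL-Library.Countable_Set"
begin

text \<open>kappa is represented by a type 'k together with a cardinal well-order r on UNIV::'k set.
  kappa is infinite and regular.\<close>

definition regular_infinite_cardinal :: "('k \<times> 'k) set \<Rightarrow> bool" where
  "regular_infinite_cardinal r \<longleftrightarrow>
     card_order r \<and> infinite (UNIV :: 'k set) \<and> regularCard r"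

definition small :: "('k \<times> 'k) set \<Rightarrow> 'k set \<Rightarrow> bool" where
  "small r X \<longleftrightarrow> (card_of X, r) \<in> ordLess"

definition kzero :: "('k \<times> 'k) set \<Rightarrow> 'k" where
  "kzero r = wo_rel.minim r (Field r)"

primrec knat :: "('k \<times> 'k) set \<Rightarrow> nat \<Rightarrow> 'k" where
  "knat r 0 = kzero r"
| "knat r (Suc m) = wo_rel.suc r {knat r m}"

text \<open>Variables are elements of 'k (kappa many variables).
  Rel m xs is the atomic formula Q_m(xs); Conj I f is the conjunction of the f i, i in I;
  Ex X phi is the existential quantification of the block of variables X.\<close>

datatype 'k fml =
    Rel nat "'k list"
  | Eq 'k 'k
  | Neg "'k fml"
  | Conj "'k set" "'k \<Rightarrow> 'k fml"
  | Ex "'k set" "'k fml"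

primrec fv :: "'k fml \<Rightarrow> 'k set" where
  "fv (Rel m xs) = set xs"
| "fv (Eq x y) = {x, y}"
| "fv (Neg \<phi>) = fv \<phi>"
| "fv (Conj I f) = (\<Union>i\<in>I. fv (f i))"
| "fv (Ex X \<phi>) = fv \<phi> - X"

text \<open>Well-formed formulas of L_{kappa^+ kappa} for the arity function ar:
  conjunctions of at most kappa formulas (indexed by I \<subseteq> kappa), quantifier blocks of fewer
  than kappa variables.\<close>
inductive wf_inf :: "('k \<times> 'k) set \<Rightarrow> (nat \<Rightarrow> nat) \<Rightarrow> 'k fml \<Rightarrow> bool" for r ar where
  "length xs = ar m \<Longrightarrow> wf_inf r ar (Rel m xs)"
| "wf_inf r ar (Eq x y)"
| "wf_inf r ar \<phi> \<Longrightarrow> wf_inf r ar (Neg \<phi>)"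
| "(\<forall>i\<in>I. wf_inf r ar (f i)) \<Longrightarrow> wf_inf r ar (Conj I f)"
| "small r X \<Longrightarrow> wf_inf r ar \<phi> \<Longrightarrow> wf_inf r ar (Ex X \<phi>)"

inductive wf_fo :: "(nat \<Rightarrow> nat) \<Rightarrow> 'k fml \<Rightarrow> bool" for ar where
  "length xs = ar m \<Longrightarrow> wf_fo ar (Rel m xs)"
| "wf_fo ar (Eq x y)"
| "wf_fo ar \<phi> \<Longrightarrow> wf_fo ar (Neg \<phi>)"
| "finite I \<Longrightarrow> (\<forall>i\<in>I. wf_fo ar (f i)) \<Longrightarrow> wf_fo ar (Conj I f)"
| "finite X \<Longrightarrow> wf_fo ar \<phi> \<Longrightarrow> wf_fo ar (Ex X \<phi>)"

text \<open>Quantifier rank at most the ordinal alpha, where alpha is (the order type of) a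
  well-order w. Ordinals alpha < kappa^+ are exactly the order types of well-orders on subsets
  of kappa. qr(atomic)=0, qr(neg phi)=qr phi, qr(conj)=sup, qr(Ex X phi)=qr phi + 1.\<close>
inductive qr_le :: "('k \<times> 'k) set \<Rightarrow> 'k fml \<Rightarrow> bool" where
  "qr_le w (Rel m xs)"
| "qr_le w (Eq x y)"
| "qr_le w \<phi> \<Longrightarrow> qr_le w (Neg \<phi>)"
| "(\<forall>i\<in>I. qr_le w (f i)) \<Longrightarrow> qr_le w (Conj I f)"
| "Well_order w' \<Longrightarrow> (w', w) \<in> ordLess \<Longrightarrow> qr_le w' \<phi> \<Longrightarrow> qr_le w (Ex X \<phi>)"

primrec sat :: "'k set \<Rightarrow> (nat \<Rightarrow> 'k list \<Rightarrow> bool) \<Rightarrow> ('k \<Rightarrow> 'k) \<Rightarrow> 'k fml \<Rightarrow> bool" where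
  "sat D M s (Rel m xs) = M m (map s xs)"
| "sat D M s (Eq x y) = (s x = s y)"
| "sat D M s (Neg \<phi>) = (\<not> sat D M s \<phi>)"
| "sat D M s (Conj I f) = (\<forall>i\<in>I. sat D M s (f i))"
| "sat D M s (Ex X \<phi>) =
     (\<exists>s'. (\<forall>v. v \<notin> X \<longrightarrow> s' v = s v) \<and> s' ` X \<subseteq> D \<and> sat D M s' \<phi>)"

definition sentence_true :: "'k set \<Rightarrow> (nat \<Rightarrow> 'k list \<Rightarrow> bool) \<Rightarrow> 'k fml \<Rightarrow> bool" where
  "sentence_true D M \<phi> \<longleftrightarrow> (\<forall>s. range s \<subseteq> D \<longrightarrow> sat D M s \<phi>)"

definition is_structure :: "(nat \<Rightarrow> nat) \<Rightarrow> 'k set \<Rightarrow> (nat \<Rightarrow> 'k list \<Rightarrow> bool) \<Rightarrow> bool" where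
  "is_structure ar D M \<longleftrightarrow> D \<noteq> {} \<and>
     (\<forall>m xs. M m xs \<longrightarrow> length xs = ar m \<and> set xs \<subseteq> D)"

definition models_theory :: "'k set \<Rightarrow> (nat \<Rightarrow> 'k list \<Rightarrow> bool) \<Rightarrow> 'k fml set \<Rightarrow> bool" where
  "models_theory D M T \<longleftrightarrow> (\<forall>\<phi>\<in>T. sentence_true D M \<phi>)"

text \<open>A countable complete first-order theory in the vocabulary L.
  Completeness is semantic; models range over all L-structures whose universe is a nonempty
  subset of the infinite set UNIV::'k (by Loewenheim-Skolem this gives the usual notion for a
  countable theory in a countable vocabulary).\<close>
definition fo_sentence :: "(nat \<Rightarrow> nat) \<Rightarrow> 'k fml \<Rightarrow> bool" where
  "fo_sentence ar \<phi> \<longleftrightarrow> wf_fo ar \<phi> \<and> fv \<phi> = {}"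

definition complete_countable_theory :: "(nat \<Rightarrow> nat) \<Rightarrow> 'k fml set \<Rightarrow> bool" where
  "complete_countable_theory ar T \<longleftrightarrow>
     countable T \<and> (\<forall>\<phi>\<in>T. fo_sentence ar \<phi>) \<and>
     (\<exists>D M. is_structure ar D M \<and> models_theory D M T) \<and>
     (\<forall>\<phi>. fo_sentence ar \<phi> \<longrightarrow>
        (\<forall>D M. is_structure ar D M \<and> models_theory D M T \<longrightarrow> sentence_true D M \<phi>) \<or>
        (\<forall>D M. is_structure ar D M \<and> models_theory D M T \<longrightarrow> sentence_true D M (Neg \<phi>)))"

text \<open>pi : kappa^{<omega} \<rightarrow> kappa is a bijection; (m, a_1, ..., a_n) is the list
  knat r m # [a_1, ..., a_n].\<close>
definition code_struct ::
  "('k \<times> 'k) set \<Rightarrow> (nat \<Rightarrow> nat) \<Rightarrow> ('k list \<Rightarrow> 'k) \<Rightarrow> ('k \<Rightarrow> 'k) \<Rightarrow> nat \<Rightarrow> 'k list \<Rightarrow> bool" where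
  "code_struct r ar \<pi> \<eta> m as \<longleftrightarrow>
     length as = ar m \<and> \<eta> (\<pi> (knat r m # as)) \<noteq> kzero r"

definition struct_iso :: "(nat \<Rightarrow> 'k list \<Rightarrow> bool) \<Rightarrow> (nat \<Rightarrow> 'k list \<Rightarrow> bool) \<Rightarrow> bool" where
  "struct_iso M N \<longleftrightarrow> (\<exists>f. bij f \<and> (\<forall>m as. M m as \<longleftrightarrow> N m (map f as)))"

definition equiv_upto :: "('k \<times> 'k) set \<Rightarrow> (nat \<Rightarrow> nat) \<Rightarrow> ('k \<times> 'k) set \<Rightarrow>
    (nat \<Rightarrow> 'k list \<Rightarrow> bool) \<Rightarrow> (nat \<Rightarrow> 'k list \<Rightarrow> bool) \<Rightarrow> bool" where
  "equiv_upto r ar w M N \<longleftrightarrow>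
     (\<forall>\<phi>. wf_inf r ar \<phi> \<and> fv \<phi> = {} \<and> qr_le w \<phi> \<longrightarrow>
        (sentence_true UNIV M \<phi> \<longleftrightarrow> sentence_true UNIV N \<phi>))"

definition iso_T :: "('k \<times> 'k) set \<Rightarrow> (nat \<Rightarrow> nat) \<Rightarrow> ('k list \<Rightarrow> 'k) \<Rightarrow> 'k fml set \<Rightarrow>
    (('k \<Rightarrow> 'k) \<times> ('k \<Rightarrow> 'k)) set" where
  "iso_T r ar \<pi> T = {(\<eta>, \<xi>).
     (models_theory UNIV (code_struct r ar \<pi> \<eta>) T \<and> models_theory UNIV (code_struct r ar \<pi> \<xi>) T \<and>
        struct_iso (code_struct r ar \<pi> \<eta>) (code_struct r ar \<pi> \<xi>)) \<or>
     (\<not> models_theory UNIV (code_struct r ar \<pi> \<eta>) T \<and> \<not> models_theory UNIV (code_struct r ar \<pi> \<xi>) T)}"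

text \<open>Basic open set N_p, p : X \<rightarrow> kappa with |X| < kappa, given as the restriction of g to X.\<close>
definition basic_nbhd :: "'k set \<Rightarrow> ('k \<Rightarrow> 'k) \<Rightarrow> ('k \<Rightarrow> 'k) set" where
  "basic_nbhd X g = {\<zeta>. \<forall>x\<in>X. \<zeta> x = g x}"

text \<open>Unions/intersections of at most kappa sets: families indexed by subsets I of kappa.\<close>
inductive_set kborel2 :: "('k \<times> 'k) set \<Rightarrow> (('k \<Rightarrow> 'k) \<times> ('k \<Rightarrow> 'k)) set set" for r where
  empty: "{} \<in> kborel2 r"
| basic: "small r X \<Longrightarrow> small r Y \<Longrightarrow> basic_nbhd X g \<times> basic_nbhd Y h \<in> kborel2 r"
| compl: "A \<in> kborel2 r \<Longrightarrow> - A \<in> kborel2 r"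
| union: "(\<forall>i\<in>(I :: 'k set). B i \<in> kborel2 r) \<Longrightarrow> (\<Union>i\<in>I. B i) \<in> kborel2 r"
| inter: "(\<forall>i\<in>(I :: 'k set). B i \<in> kborel2 r) \<Longrightarrow> (\<Inter>i\<in>I. B i) \<in> kborel2 r"

end

theory Submission
  imports Defs
begin

text \<open>
  Suppose isomorphism is \<open>\<kappa>\<close>-Borel. Fix \<open>\<eta>\<close> and consider copies of a structure \<open>N\<close> along generic
  bijections \<open>\<kappa> \<rightarrow> N\<close>, for the forcing whose conditions are the injective sequences in \<open>N\<close> of length
  less than \<open>\<kappa>\<close>. By induction on a \<open>\<kappa>\<close>-Borel set \<open>A\<close>, ``the condition forces the code of the generic
  copy into the section of \<open>A\<close> at \<open>\<eta>\<close>'' is expressed in \<open>N\<close> by formulas of \<open>L\<^sub>\<kappa>\<^sub>+\<^sub>\<kappa>\<close> whose quantifier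
  rank is bounded below \<open>\<kappa>\<^sup>+\<close> in terms of \<open>A\<close> only, not of \<open>\<eta>\<close> (a Vaught transform). Apply this to
  the complement of the isomorphism relation: the sentence ``no condition forces the generic copy
  to be non-isomorphic to \<open>M\<^sub>\<eta>\<close>'' holds in \<open>M\<^sub>\<eta>\<close>, hence in \<open>M\<^sub>\<eta>\<^sub>'\<close> if both agree up to the bounding rank,
  and then a generic copy of \<open>M\<^sub>\<eta>\<^sub>'\<close> is isomorphic to \<open>M\<^sub>\<eta>\<close>.
\<close>

unbundle cardinal_syntax

section \<open>Formulas: quantifier rank, satisfaction and isomorphic copies\<close>

lemma qr_le_mono:
  assumes "qr_le w \<phi>" and "w \<le>o w'"
  shows "qr_le w' \<phi>"
  using assms
  by (induction arbitrary: w' rule: qr_le.induct)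
     (auto intro: qr_le.intros ordLess_ordLeq_trans)

lemma sat_cong:
  assumes "\<And>x. x \<in> fv \<phi> \<Longrightarrow> s x = s' x"
  shows "sat D M s \<phi> \<longleftrightarrow> sat D M s' \<phi>"
  using assms
proof (induction \<phi> arbitrary: s s')
  case (Rel m xs)
  then have "map s xs = map s' xs" by simp
  then show ?case unfolding sat.simps by (rule arg_cong)
next
  case (Neg \<phi>)
  show ?case using Neg.IH[of s s'] Neg.prems by simp
next
  case (Conj I f)
  have "sat D M s (f i) \<longleftrightarrow> sat D M s' (f i)" if "i \<in> I" for i
    by (rule Conj.IH) (use that Conj.prems in auto)
  then show ?case by simp
next
  case (Ex X \<phi>)
  have "sat D M t' (Ex X \<phi>)" if "sat D M t (Ex X \<phi>)" "\<And>x. x \<in> fv \<phi> - X \<Longrightarrow> t x = t' x" for t t'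
  proof -
    obtain u where u: "\<forall>v. v \<notin> X \<longrightarrow> u v = t v" "u ` X \<subseteq> D" "sat D M u \<phi>"
      using \<open>sat D M t (Ex X \<phi>)\<close> by auto
    let ?u = "\<lambda>v. if v \<in> X then u v else t' v"
    have "sat D M ?u \<phi>"
      using u(3) Ex.IH[of u ?u] u(1) that(2) by auto
    moreover have "?u ` X \<subseteq> D" using u(2) by auto
    ultimately show ?thesis unfolding sat.simps by (intro exI[of _ ?u]) simp
  qed
  from this[of s s'] this[of s' s] show ?case
    using Ex.prems by (auto simp del: sat.simps)
qed simp

text \<open>The structure on the left is the copy of \<open>N\<close> along \<open>h\<close>, so
  \<open>h\<close> is an isomorphism from it onto \<open>N\<close>. At a quantifier, a witnessing
  assignment \<open>t\<close> in \<open>N\<close> is pulled back to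
  \<open>inv h \<circ> t\<close>.\<close>

lemma sat_bij:
  assumes "bij h"
  shows "sat UNIV (\<lambda>m as. N m (map h as)) s \<phi> \<longleftrightarrow> sat UNIV N (h \<circ> s) \<phi>"
proof (induction \<phi> arbitrary: s)
  case (Eq x y)
  then show ?case using assms by (simp add: bij_is_inj inj_eq)
next
  case (Ex X \<phi>)
  have "sat UNIV (\<lambda>m as. N m (map h as)) s (Ex X \<phi>) \<longleftrightarrow>
      (\<exists>s'. (\<forall>v. v \<notin> X \<longrightarrow> s' v = s v) \<and> sat UNIV N (h \<circ> s') \<phi>)"
    using Ex.IH by (simp add: comp_def)
  also have "\<dots> \<longleftrightarrow> (\<exists>t. (\<forall>v. v \<notin> X \<longrightarrow> t v = h (s v)) \<and> sat UNIV N t \<phi>)"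
  proof
    assume "\<exists>t. (\<forall>v. v \<notin> X \<longrightarrow> t v = h (s v)) \<and> sat UNIV N t \<phi>"
    then obtain t where t: "\<forall>v. v \<notin> X \<longrightarrow> t v = h (s v)" "sat UNIV N t \<phi>" by blast
    have "h \<circ> (inv h \<circ> t) = t"
      using assms by (simp add: fun_eq_iff bij_is_surj surj_f_inv_f)
    then show "\<exists>s'. (\<forall>v. v \<notin> X \<longrightarrow> s' v = s v) \<and> sat UNIV N (h \<circ> s') \<phi>"
      using t assms by (intro exI[of _ "inv h \<circ> t"]) (simp add: bij_is_inj)
  qed (metis comp_apply)
  also have "\<dots> \<longleftrightarrow> sat UNIV N (h \<circ> s) (Ex X \<phi>)" by simp
  finally show ?case .
qed (auto simp: comp_def)

lemma models_theory_bij: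
  assumes "bij h" and "models_theory UNIV N T"
  shows "models_theory UNIV (\<lambda>m as. N m (map h as)) T"
  using assms by (auto simp: models_theory_def sentence_true_def sat_bij)

lemma struct_iso_trans:
  assumes "struct_iso M N" "struct_iso N K"
  shows "struct_iso M K"
proof -
  obtain f g where "bij f" "\<forall>m as. M m as \<longleftrightarrow> N m (map f as)"
    "bij g" "\<forall>m as. N m as \<longleftrightarrow> K m (map g as)"
    using assms unfolding struct_iso_def by blast
  then show ?thesis
    unfolding struct_iso_def by (intro exI[of _ "g \<circ> f"]) (auto simp: bij_comp)
qed

text \<open>Indices of \<open>Conj\<close> are elements of \<open>'k\<close>, so a binary
  conjunction is coded over all of \<open>'k\<close>: the index \<open>undefined\<close> carries the
  first conjunct, every other index the second.\<close>

definition And :: "'k fml \<Rightarrow> 'k fml \<Rightarrow> 'k fml" where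
  "And \<phi> \<psi> = Conj UNIV (\<lambda>i. if i = undefined then \<phi> else \<psi>)"

definition inj_fml :: "'k set \<Rightarrow> 'k fml" where
  "inj_fml X = Conj X (\<lambda>i. Conj (X - {i}) (\<lambda>j. Neg (Eq i j)))"

definition Falsum :: "'k fml" where
  "Falsum = Neg (Conj {} (\<lambda>_. Eq undefined undefined))"

lemma inj_fml_simps [simp]:
  "sat D M s (inj_fml X) \<longleftrightarrow> inj_on s X" "fv (inj_fml X) \<subseteq> X"
  "wf_inf r ar (inj_fml X)" "qr_le w (inj_fml X)"
  by (auto simp: inj_fml_def inj_on_def intro!: wf_inf.intros qr_le.intros)

lemma Falsum_simps [simp]:
  "\<not> sat D M s Falsum" "fv Falsum = {}" "wf_inf r ar Falsum" "qr_le w Falsum"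
  by (auto simp: Falsum_def intro!: wf_inf.intros qr_le.intros)

section \<open>Order and regularity of \<kappa>, and bounds below \<kappa>^+\<close>

locale kappa_coding =
  fixes r :: "('k \<times> 'k) set" and ar :: "nat \<Rightarrow> nat" and \<pi> :: "'k list \<Rightarrow> 'k"
  assumes reg: "regular_infinite_cardinal r" and inj_pi: "inj \<pi>"
begin

lemma
  shows Card_order: "Card_order r" and Field_r: "Field r = UNIV" and regular: "regularCard r"
    and infinite_UNIV: "infinite (UNIV :: 'k set)"
  using reg card_order_on_Card_order[of UNIV r] unfolding regular_infinite_cardinal_def by auto

lemma Well_order: "Well_order r"
  using Card_order by (simp add: card_order_on_well_order_on)

lemma wo_rel: "wo_rel r"
  using Well_order by (simp add: wo_rel_def)

lemma
  shows refl: "(a, a) \<in> r"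
    and trans: "(a, b) \<in> r \<Longrightarrow> (b, c) \<in> r \<Longrightarrow> (a, c) \<in> r"
    and antisym: "(a, b) \<in> r \<Longrightarrow> (b, a) \<in> r \<Longrightarrow> a = b"
    and total: "(a, b) \<in> r \<or> (b, a) \<in> r"
  using Well_order Field_r unfolding order_on_defs
  by (auto dest: refl_onD transD antisymD) (metis UNIV_I refl_on_def total_on_def)

lemma card_UNIV: "|UNIV :: 'k set| =o r"
  using card_of_Field_ordIso[OF Card_order] Field_r by simp

lemma card_ordLess_UNIV_iff: "|X| <o r \<longleftrightarrow> |X| <o |UNIV :: 'k set|"
  using card_UNIV ordIso_symmetric ordLess_ordIso_trans by blast

lemma underS_iff: "i \<in> underS r b \<longleftrightarrow> (b, i) \<notin> r"
  using total[of i b] antisym[of i b] refl[of b] by (auto simp: underS_def)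

lemma underS_mono: "(b, b') \<in> r \<Longrightarrow> underS r b \<subseteq> underS r b'"
  by (rule subsetI) (use trans[of b b'] in \<open>unfold underS_iff, blast\<close>)

lemma small_underS: "small r (underS r b)"
  unfolding small_def by (rule card_of_underS[OF Card_order]) (simp add: Field_r)

lemma small_subset: "small r X \<Longrightarrow> Y \<subseteq> X \<Longrightarrow> small r Y"
  unfolding small_def by (rule ordLeq_ordLess_trans[OF card_of_mono1])

lemma small_image: "small r X \<Longrightarrow> small r (f ` X)"
  unfolding small_def by (rule ordLeq_ordLess_trans[OF card_of_image])

lemma small_finite: "finite X \<Longrightarrow> small r X"
  unfolding small_def
  by (rule finite_ordLess_infinite[OF card_of_Well_order Well_order])
     (simp_all add: Field_r infinite_UNIV Field_card_of)

lemma ex_greater: "\<exists>b. a \<in> underS r b"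
  using Card_order_infinite_not_under[OF Card_order] Field_r infinite_UNIV
  by (auto simp: underS_iff under_def)

text \<open>This is the regularity of \<kappa>: an unbounded set is cofinal and therefore has
  cardinality \<kappa>.\<close>

lemma small_bounded:
  assumes "small r X"
  shows "\<exists>b. X \<subseteq> underS r b"
proof (rule ccontr)
  assume *: "\<nexists>b. X \<subseteq> underS r b"
  have "cofinal X r"
    unfolding cofinal_def
  proof
    fix a
    \<comment> \<open>\<open>cofinal\<close> asks for an element strictly above \<open>a\<close>;
      one that is at least some \<open>b\<close> greater than \<open>a\<close> will do.\<close>
    obtain b where b: "a \<in> underS r b" using ex_greater by blast
    obtain x where "x \<in> X" "(b, x) \<in> r" using * by (force simp: underS_iff)
    moreover have "(a, x) \<in> r" using b trans[OF _ \<open>(b, x) \<in> r\<close>] by (simp add: underS_def)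
    moreover have "a \<noteq> x" using b \<open>(b, x) \<in> r\<close> by (auto simp: underS_iff)
    ultimately show "\<exists>x\<in>X. a \<noteq> x \<and> (a, x) \<in> r" by blast
  qed
  then have "|X| =o r" using regular Field_r unfolding regularCard_def by auto
  then show False using assms not_ordLess_ordIso unfolding small_def by blast
qed

lemma
  shows knat_Suc: "knat r m \<in> underS r (knat r (Suc m))"
    and underS_kzero: "underS r (kzero r) = {}"
proof -
  have "AboveS r {knat r m} \<noteq> {}"
    using ex_greater[of "knat r m"] Field_r unfolding AboveS_def underS_def by blast
  then show "knat r m \<in> underS r (knat r (Suc m))"
    using wo_rel.suc_greater[OF wo_rel, of "{knat r m}" "knat r m"] Field_r
    by (auto simp: underS_def)
  show "underS r (kzero r) = {}"
    using wo_rel.minim_least[OF wo_rel, of UNIV] Field_r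
    unfolding kzero_def by (auto simp: underS_iff)
qed

lemma kzero_le: "(kzero r, b) \<in> r"
  using underS_kzero by (auto simp: underS_iff)

lemma knat_less: "m < n \<Longrightarrow> knat r m \<in> underS r (knat r n)"
proof (induction n)
  case (Suc n)
  then show ?case
    using knat_Suc[of n] underS_mono[of "knat r n" "knat r (Suc n)"]
    by (auto simp: less_Suc_eq underS_def)
qed simp

lemma inj_knat: "inj (knat r)"
  by (rule linorder_injI) (use knat_less refl in \<open>force simp: underS_iff\<close>)

text \<open>The order types in question lie below \<kappa>^+, which is regular, so \<kappa> many of
  them are bounded by an initial segment of \<open>cardSuc r\<close>. That segment has at most
  \<kappa> elements and is copied back into \<open>'k\<close> by an injection. This keeps rank
  bounds below \<kappa>^+ under complements and unions.\<close>

lemma ex_Well_order_greater: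
  fixes w :: "'k \<Rightarrow> ('k \<times> 'k) set"
  assumes w: "\<And>i. i \<in> I \<Longrightarrow> Well_order (w i)"
  shows "\<exists>v :: ('k \<times> 'k) set. Well_order v \<and> (\<forall>i\<in>I. w i <o v)"
proof -
  let ?S = "cardSuc r"
  have CS: "Card_order ?S" by (simp add: Card_order cardSuc_Card_order)
  have WS: "Well_order ?S" by (simp add: CS card_order_on_well_order_on)
  have rS: "r <o ?S" by (simp add: Card_order cardSuc_greater)
  have leS: "|X| <o ?S" for X :: "'k set"
    using card_of_mono1[of X UNIV] card_UNIV rS
    by (meson ordLeq_ordIso_trans ordLeq_ordLess_trans subset_UNIV)
  \<comment> \<open>A field of size at most \<kappa> cannot carry an order as long as \<kappa>^+, so
    each \<open>w i\<close> is isomorphic to the elements below some \<open>a i\<close>.\<close>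
  have "\<exists>a\<in>Field ?S. w i =o Restr ?S (underS ?S a)" if "i \<in> I" for i
  proof -
    have "\<not> ?S \<le>o w i"
    proof
      assume "?S \<le>o w i"
      then have "|Field ?S| \<le>o |Field (w i)|" by (rule card_of_mono2)
      then have "?S \<le>o |Field (w i)|"
        using card_of_Field_ordIso[OF CS] ordIso_ordLeq_trans ordIso_symmetric by blast
      then show False using leS not_ordLess_ordLeq by blast
    qed
    then have "w i <o ?S" using WS w[OF that] by (simp add: not_ordLeq_iff_ordLess)
    then show ?thesis using ordLess_iff_ordIso_Restr[OF WS w[OF that]] by simp
  qed
  then obtain a where a: "\<And>i. i \<in> I \<Longrightarrow> a i \<in> Field ?S"
      "\<And>i. i \<in> I \<Longrightarrow> w i =o Restr ?S (underS ?S (a i))"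
    by metis
  have "|a ` I| <o ?S" using leS card_of_image ordLeq_ordLess_trans by blast
  then have "\<not> |a ` I| =o ?S" using not_ordLess_ordIso by blast
  moreover have "regularCard ?S"
    by (rule infinite_cardSuc_regularCard[OF _ Card_order]) (simp add: Field_r infinite_UNIV)
  ultimately have "\<not> cofinal (a ` I) ?S"
    using a(1) unfolding regularCard_def by blast
  then obtain b where b: "b \<in> Field ?S" "\<And>i. i \<in> I \<Longrightarrow> a i = b \<or> (b, a i) \<notin> ?S"
    unfolding cofinal_def by blast
  have lin: "(x, y) \<in> ?S \<or> (y, x) \<in> ?S" if "x \<in> Field ?S" "y \<in> Field ?S" for x y
    using WS that unfolding order_on_defs by (metis refl_on_def total_on_def)
  have trS: "(x, z) \<in> ?S" if "(x, y) \<in> ?S" "(y, z) \<in> ?S" for x y z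
    using WS that unfolding order_on_defs by (meson transD)
  have asS: "x = y" if "(x, y) \<in> ?S" "(y, x) \<in> ?S" for x y
    using WS that unfolding order_on_defs by (meson antisymD)
  \<comment> \<open>All \<open>a i\<close> are at most \<open>b\<close>. A \<open>c\<close> strictly
    above \<open>b\<close> makes the inclusions of initial segments proper, which gives strict
    inequalities of order types.\<close>
  have "infinite (Field ?S)" by (simp add: cardSuc_finite[OF Card_order] Field_r infinite_UNIV)
  then have "Field ?S \<noteq> under ?S b" using Card_order_infinite_not_under[OF CS] by blast
  moreover have "under ?S b \<subseteq> Field ?S" by (auto simp: under_def Field_def)
  ultimately obtain c where c: "c \<in> Field ?S" "(c, b) \<notin> ?S"
    unfolding under_def by blast
  have "underS ?S (a i) \<subset> underS ?S c" if "i \<in> I" for i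
  proof -
    have "(a i, c) \<in> ?S" "(c, a i) \<notin> ?S"
      using lin[OF a(1)[OF that] b(1)] lin[OF b(1) c(1)] b(2)[OF that] c(2) trS by blast+
    then show ?thesis unfolding underS_def using trS asS by blast
  qed
  moreover have "wo_rel.ofilter ?S (underS ?S x)" for x
    using WS by (simp add: wo_rel.underS_ofilter wo_rel_def)
  ultimately have lt: "w i <o Restr ?S (underS ?S c)" if "i \<in> I" for i
    using ordIso_ordLess_trans[OF a(2)[OF that]] ofilter_subset_ordLess[OF WS] that by blast
  have "|underS ?S c| \<le>o |UNIV :: 'k set|"
    using card_of_underS[OF CS c(1)] cardSuc_ordLeq_ordLess[OF Card_order card_of_Card_order]
      card_UNIV ordIso_symmetric ordLeq_ordIso_trans by blast
  then obtain f :: "'k set \<Rightarrow> 'k" where f: "inj_on f (underS ?S c)"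
    by (meson card_of_ordLeq)
  let ?R = "Restr ?S (underS ?S c)"
  have "Well_order ?R" using WS by (rule Well_order_Restr)
  moreover have "inj_on f (Field ?R)"
    by (rule inj_on_subset[OF f Field_Restr_subset])
  ultimately have "Well_order (dir_image ?R f)" "?R =o dir_image ?R f"
    by (simp_all add: Well_order_dir_image dir_image_ordIso)
  then show ?thesis using lt ordLess_ordIso_trans by blast
qed

section \<open>Conditions and generic bijections\<close>

text \<open>A pair \<open>(b, s)\<close> stands for the sequence of length \<open>b\<close> given by \<open>s\<close> below \<open>b\<close>; the values
  of \<open>s\<close> elsewhere are irrelevant. Conditions are the injective such sequences, i.e. the pairs that
  extend themselves. Since only initial segments of \<open>\<kappa>\<close> occur as domains, extensions of a condition
  can be described with \<open>\<kappa>\<close> many quantifier blocks without assuming \<open>\<kappa>\<^bsup><\<kappa>\<^esup> = \<kappa>\<close>.\<close>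

definition extends :: "'k \<times> ('k \<Rightarrow> 'k) \<Rightarrow> 'k \<times> ('k \<Rightarrow> 'k) \<Rightarrow> bool" where
  "extends p q \<longleftrightarrow> (fst p, fst q) \<in> r \<and> (\<forall>i\<in>underS r (fst p). snd q i = snd p i) \<and>
     inj_on (snd q) (underS r (fst q))"

definition dense :: "('k \<times> ('k \<Rightarrow> 'k)) set \<Rightarrow> bool" where
  "dense D \<longleftrightarrow> (\<forall>p. extends p p \<longrightarrow> (\<exists>q\<in>D. extends p q))"

definition meets :: "('k \<Rightarrow> 'k) \<Rightarrow> ('k \<times> ('k \<Rightarrow> 'k)) set \<Rightarrow> bool" where
  "meets h D \<longleftrightarrow> (\<exists>q\<in>D. \<forall>i\<in>underS r (fst q). h i = snd q i)"

lemma extends_trans: "extends p q \<Longrightarrow> extends q q' \<Longrightarrow> extends p q'"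
  unfolding extends_def using trans underS_mono by (metis subsetD)

lemma extends_refl_right: "extends p q \<Longrightarrow> extends q q"
  unfolding extends_def by (simp add: refl)

text \<open>Both \<open>X\<close> and its image have fewer than \<kappa> elements, so their
  complements have cardinality \<kappa>; \<open>s\<close> is glued to any bijection between these
  complements.\<close>

lemma small_inj_on_extends_bij:
  fixes s :: "'k \<Rightarrow> 'k"
  assumes "small r X" and "inj_on s X"
  shows "\<exists>h. bij h \<and> (\<forall>i\<in>X. h i = s i)"
proof -
  have compl: "|UNIV :: 'k set| =o |- Y|" if "small r Y" for Y :: "'k set"
  proof -
    have Y: "|Y| <o |UNIV :: 'k set|" using that card_ordLess_UNIV_iff unfolding small_def by blast
    have "\<not> |- Y| <o |UNIV :: 'k set|"
    proof
      assume "|- Y| <o |UNIV :: 'k set|"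
      then have "|Y \<union> - Y| <o |UNIV :: 'k set|"
        by (rule card_of_Un_ordLess_infinite[OF infinite_UNIV Y])
      then show False using ordLess_irreflexive by auto
    qed
    then show ?thesis
      using card_of_mono1[of "- Y" UNIV]
      by (metis card_of_Well_order not_ordLess_iff_ordLeq ordIso_iff_ordLeq top_greatest)
  qed
  have "|- X| =o |- s ` X|"
    using compl[OF assms(1)] compl[OF small_image[OF assms(1)]] ordIso_symmetric ordIso_transitive
    by blast
  then obtain g where g: "bij_betw g (- X) (- s ` X)" using card_of_ordIso by blast
  let ?h = "\<lambda>i. if i \<in> X then s i else g i"
  have "bij_betw ?h X (s ` X)"
    using assms(2) by (auto simp: bij_betw_def inj_on_def)
  moreover have "bij_betw ?h (- X) (- s ` X)"
    using g by (subst bij_betw_cong[of _ _ g]) auto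
  ultimately have "bij_betw ?h (X \<union> - X) (s ` X \<union> - s ` X)"
    by (rule bij_betw_combine) auto
  then have "bij ?h" by simp
  then show ?thesis by (intro exI[of _ ?h]) simp
qed

text \<open>This makes the generic sequence total and surjective. The condition is extended to a
  bijection \<open>h\<close> of \<kappa>, which is then cut off beyond \<open>x\<close> and
  \<open>inv h x\<close>.\<close>

lemma extends_into_domain_and_range:
  assumes "extends p p"
  shows "\<exists>q. extends p q \<and> x \<in> underS r (fst q) \<and> x \<in> snd q ` underS r (fst q)"
proof -
  obtain h where h: "bij h" "\<forall>i\<in>underS r (fst p). h i = snd p i"
    using small_inj_on_extends_bij[OF small_underS] assms unfolding extends_def by blast
  have "small r {fst p, x, inv h x}" by (simp add: small_finite)
  then obtain b where b: "{fst p, x, inv h x} \<subseteq> underS r b" using small_bounded by blast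
  have "h (inv h x) = x" using h(1) by (simp add: bij_is_surj surj_f_inv_f)
  then have "x \<in> h ` underS r b" using b by (metis image_eqI insert_subset)
  moreover have "extends p (b, h)"
    using b h inj_on_subset[OF bij_is_inj[OF h(1)], of "underS r b"]
    unfolding extends_def by (auto simp: underS_def)
  ultimately show ?thesis using b by (intro exI[of _ "(b, h)"]) auto
qed

text \<open>The upper bound is the union of the chain. Its domain omits \<open>b\<close>, so it is a
  proper initial segment and hence of the form \<open>underS r a\<close>.\<close>

lemma chain_bounded:
  assumes chain: "\<And>p q. p \<in> C \<Longrightarrow> q \<in> C \<Longrightarrow> extends p q \<or> extends q p"
    and bdd: "\<And>p. p \<in> C \<Longrightarrow> (fst p, b) \<in> r"
  shows "\<exists>q. extends q q \<and> (\<forall>p\<in>C. extends p q)"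
proof -
  let ?A = "\<Union>p\<in>C. underS r (fst p)"
  have "?A \<subseteq> underS r b" using bdd underS_mono by blast
  then have "?A \<noteq> UNIV" using underS_notIn[of b r] by blast
  moreover have "wo_rel.ofilter r ?A"
    by (intro wo_rel.ofilter_UNION[OF wo_rel] wo_rel.underS_ofilter[OF wo_rel])
  ultimately obtain a where a: "?A = underS r a"
    using wo_rel.ofilter_underS_Field[OF wo_rel] Field_r by metis
  \<comment> \<open>The choice of \<open>p\<close> is immaterial, since members of the chain agree
    on common positions.\<close>
  define s where "s i = snd (SOME p. p \<in> C \<and> i \<in> underS r (fst p)) i" for i
  have s: "s i = snd p i" if "p \<in> C" "i \<in> underS r (fst p)" for p i
  proof -
    define q where "q = (SOME p. p \<in> C \<and> i \<in> underS r (fst p))"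
    have "q \<in> C \<and> i \<in> underS r (fst q)"
      unfolding q_def by (rule someI[of _ p]) (use that in simp)
    then have "snd q i = snd p i" using chain[of p q] that unfolding extends_def by auto
    then show ?thesis by (simp add: s_def q_def)
  qed
  have "inj_on s (underS r a)"
  proof (rule inj_onI)
    fix i j assume ij: "i \<in> underS r a" "j \<in> underS r a" "s i = s j"
    then obtain p q where pq: "p \<in> C" "i \<in> underS r (fst p)" "q \<in> C" "j \<in> underS r (fst q)"
      using a by blast
    obtain t where "t \<in> C" "i \<in> underS r (fst t)" "j \<in> underS r (fst t)"
      using chain[of p q] pq underS_mono unfolding extends_def by blast
    moreover have "inj_on (snd t) (underS r (fst t))"
      using chain \<open>t \<in> C\<close> unfolding extends_def by blast
    ultimately show "i = j" using ij(3) s by (metis inj_onD)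
  qed
  moreover have "(fst p, a) \<in> r" if "p \<in> C" for p
    using that a refl[of a] by (metis UN_I underS_iff)
  ultimately show ?thesis
    using s by (intro exI[of _ "(a, s)"]) (auto simp: extends_def refl)
qed

text \<open>A Rasiowa-Sikorski construction of length \<kappa>. Limits exist because, by regularity,
  the lengths reached before stage \<open>x\<close> are bounded in \<kappa>.\<close>

lemma ex_generic_bij:
  fixes \<D> :: "('k \<times> ('k \<Rightarrow> 'k)) set set"
  assumes card: "|\<D>| \<le>o |UNIV :: 'k set|" and dense: "\<And>D. D \<in> \<D> \<Longrightarrow> dense D"
    and p0: "extends p0 p0"
  shows "\<exists>h. bij h \<and> (\<forall>i\<in>underS r (fst p0). h i = snd p0 i) \<and> (\<forall>D\<in>\<D>. meets h D)"
proof -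
  obtain e :: "('k \<times> ('k \<Rightarrow> 'k)) set \<Rightarrow> 'k" where e: "inj_on e \<D>"
    using card card_of_ordLeq by (metis)
  \<comment> \<open>Stage \<open>x\<close> extends \<open>p0\<close> and all earlier stages, puts
    \<open>x\<close> into domain and range, and enters the dense set labelled \<open>x\<close> by
    \<open>e\<close>, if there is one.\<close>
  define P where "P f x q \<longleftrightarrow> extends p0 q \<and> (\<forall>y\<in>underS r x. extends (f y) q) \<and>
      x \<in> underS r (fst q) \<and> x \<in> snd q ` underS r (fst q) \<and> (\<forall>D\<in>\<D>. e D = x \<longrightarrow> q \<in> D)"
    for f :: "'k \<Rightarrow> 'k \<times> ('k \<Rightarrow> 'k)" and x q
  have "\<exists>f. \<forall>x. P f x (f x)"
  proof (rule dependent_wf_choice)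
    show "wf (r - Id)" using Well_order by (simp add: well_order_on_def)
  next
    fix f g :: "'k \<Rightarrow> 'k \<times> ('k \<Rightarrow> 'k)" and x q
    assume "\<And>z. (z, x) \<in> r - Id \<Longrightarrow> f z = g z"
    then have "\<forall>y\<in>underS r x. f y = g y" by (auto simp: underS_def)
    then show "P f x q = P g x q" by (simp add: P_def)
  next
    fix f x assume "\<And>y. (y, x) \<in> r - Id \<Longrightarrow> P f y (f y)"
    then have IH: "P f y (f y)" if "y \<in> underS r x" for y using that by (simp add: underS_def)
    have ext: "extends (f y) (f z)" if "y \<in> underS r z" "z \<in> underS r x" for y z
      using IH[OF that(2)] that(1) unfolding P_def by blast
    have self: "extends (f y) (f y)" if "y \<in> underS r x" for y
      using IH[OF that] extends_refl_right unfolding P_def by blast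
    let ?C = "insert p0 (f ` underS r x)"
    obtain b where b: "(fst \<circ> f) ` underS r x \<subseteq> underS r b"
      using small_bounded small_image small_underS by metis
    \<comment> \<open>The larger of the length of \<open>p0\<close> and the bound \<open>b\<close>
      on the earlier lengths.\<close>
    define c where "c = (if (b, fst p0) \<in> r then fst p0 else b)"
    have "\<exists>q. extends q q \<and> (\<forall>p\<in>?C. extends p q)"
    proof (rule chain_bounded)
      fix p q assume pq: "p \<in> ?C" "q \<in> ?C"
      have "extends (f y) (f z) \<or> extends (f z) (f y)" if "y \<in> underS r x" "z \<in> underS r x" for y z
        using ext[of y z] ext[of z y] self that antisym[of y z] by (auto simp: underS_iff)
      moreover have "extends p0 (f y)" if "y \<in> underS r x" for y
        using IH[OF that] unfolding P_def by blast
      ultimately show "extends p q \<or> extends q p" using pq p0 by auto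
    next
      fix p assume "p \<in> ?C"
      then consider "p = p0" | "fst p \<in> underS r b" using b by auto
      then show "(fst p, c) \<in> r"
        by cases (use total refl trans in \<open>auto simp: c_def underS_def\<close>)
    qed
    then obtain q where q: "extends q q" "\<And>p. p \<in> ?C \<Longrightarrow> extends p q" by blast
    obtain q' where q': "extends q q'" "x \<in> underS r (fst q')" "x \<in> snd q' ` underS r (fst q')"
      using extends_into_domain_and_range[OF q(1)] by blast
    have "\<exists>t. extends q' t \<and> (\<forall>D\<in>\<D>. e D = x \<longrightarrow> t \<in> D)"
    proof (cases "\<exists>D\<in>\<D>. e D = x")
      case True
      then obtain D where D: "D \<in> \<D>" "e D = x" by blast
      obtain t where "t \<in> D" "extends q' t"
        using dense[OF D(1)] extends_refl_right[OF q'(1)] unfolding dense_def by blast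
      moreover have "D' = D" if "D' \<in> \<D>" "e D' = x" for D'
        using e D that by (metis inj_onD)
      ultimately show ?thesis by blast
    qed (use extends_refl_right[OF q'(1)] in blast)
    then obtain t where t: "extends q' t" "\<forall>D\<in>\<D>. e D = x \<longrightarrow> t \<in> D" by blast
    have "underS r (fst q') \<subseteq> underS r (fst t)" "\<forall>i\<in>underS r (fst q'). snd t i = snd q' i"
      using t(1) underS_mono unfolding extends_def by auto
    then have "x \<in> underS r (fst t)" "x \<in> snd t ` underS r (fst t)"
      using q'(2,3) by (auto simp: image_iff subset_iff) metis
    moreover have "extends p t" if "p \<in> ?C" for p
      using q(2)[OF that] q'(1) t(1) extends_trans by blast
    ultimately have "P f x t" using t(2) unfolding P_def by blast
    then show "\<exists>t. P f x t" ..
  qed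
  then obtain f where f: "\<And>x. P f x (f x)" by blast
  \<comment> \<open>Position \<open>i\<close> belongs to the domain of stage \<open>i\<close>, and
    any two stages are comparable, so the diagonal agrees with every stage on its domain.\<close>
  define h where "h i = snd (f i) i" for i
  have dom: "x \<in> underS r (fst (f x))" for x using f unfolding P_def by blast
  have h: "h i = snd (f x) i" if "i \<in> underS r (fst (f x))" for i x
  proof -
    consider "i = x" | "i \<in> underS r x" | "x \<in> underS r i"
      using antisym[of i x] by (auto simp: underS_iff)
    then show ?thesis
    proof cases
      case 2
      then have "extends (f i) (f x)" using f[of x] unfolding P_def by blast
      then show ?thesis using dom[of i] unfolding extends_def h_def by simp
    next
      case 3
      then have "extends (f x) (f i)" using f[of i] unfolding P_def by blast
      then show ?thesis using that unfolding extends_def h_def by simp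
    qed (simp add: h_def)
  qed
  have self: "extends p0 (f x)" "extends (f x) (f x)" for x
    using f[of x] extends_refl_right unfolding P_def by blast+
  have "inj h"
  proof (rule injI)
    fix i j assume eq: "h i = h j"
    have "\<exists>x. i \<in> underS r (fst (f x)) \<and> j \<in> underS r (fst (f x))"
    proof -
      obtain x where x: "{i, j} \<subseteq> underS r x"
        using small_bounded[OF small_finite[of "{i, j}"]] by auto
      have "(x, fst (f x)) \<in> r" using dom[of x] by (simp add: underS_def)
      then show ?thesis using x underS_mono by blast
    qed
    then obtain x where x: "i \<in> underS r (fst (f x))" "j \<in> underS r (fst (f x))" by blast
    then show "i = j" using h[OF x(1)] h[OF x(2)] eq self(2)[of x] unfolding extends_def
      by (metis inj_onD)
  qed
  moreover have "surj h"
  proof -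
    have "x \<in> range h" for x
    proof -
      obtain i where "i \<in> underS r (fst (f x))" "x = snd (f x) i"
        using f[of x] unfolding P_def by blast
      then show ?thesis using h by (metis rangeI)
    qed
    then show ?thesis by blast
  qed
  ultimately have "bij h" by (simp add: bij_def)
  moreover have "h i = snd p0 i" if "i \<in> underS r (fst p0)" for i
  proof -
    have "(fst p0, fst (f i)) \<in> r" "snd (f i) i = snd p0 i"
      using self(1)[of i] that unfolding extends_def by auto
    then show ?thesis by (simp add: h_def)
  qed
  moreover have "meets h D" if "D \<in> \<D>" for D
    using f[of "e D"] that h[of _ "e D"] unfolding meets_def P_def by blast
  ultimately show ?thesis by blast
qed

section \<open>Quantifying over the extensions of a condition\<close>

lemma And_simps:
  fixes \<phi> \<psi> :: "'k fml"
  shows "sat D M s (And \<phi> \<psi>) \<longleftrightarrow> sat D M s \<phi> \<and> sat D M s \<psi>"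
    and "fv (And \<phi> \<psi>) = fv \<phi> \<union> fv \<psi>"
proof -
  obtain i :: 'k where i: "i \<noteq> undefined"
    using infinite_UNIV by (metis finite.emptyI finite_insert UNIV_eq_I insertI1)
  show "sat D M s (And \<phi> \<psi>) \<longleftrightarrow> sat D M s \<phi> \<and> sat D M s \<psi>"
    using i by (auto simp: And_def)
  show "fv (And \<phi> \<psi>) = fv \<phi> \<union> fv \<psi>"
    using i by (auto simp: And_def split: if_splits)
qed

text \<open>This is forcing of a negation. The conjunction runs over the possible lengths
  \<open>c\<close> of an extension, and each block binds only the new positions from
  \<open>b\<close> up to \<open>c\<close>, leaving the given condition fixed.\<close>

definition no_ext :: "('k \<Rightarrow> 'k fml) \<Rightarrow> 'k \<Rightarrow> 'k fml" where
  "no_ext \<Phi> b = Conj {c. (b, c) \<in> r}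
     (\<lambda>c. Neg (Ex (underS r c - underS r b) (And (inj_fml (underS r c)) (\<Phi> c))))"

lemma sat_no_ext:
  assumes fv: "\<And>c. fv (\<Phi> c) \<subseteq> underS r c"
  shows "sat UNIV N s (no_ext \<Phi> b) \<longleftrightarrow>
    (\<forall>q. extends (b, s) q \<longrightarrow> \<not> sat UNIV N (snd q) (\<Phi> (fst q)))"
proof
  assume L: "sat UNIV N s (no_ext \<Phi> b)"
  show "\<forall>q. extends (b, s) q \<longrightarrow> \<not> sat UNIV N (snd q) (\<Phi> (fst q))"
  proof (intro allI impI notI)
    fix q assume q: "extends (b, s) q" "sat UNIV N (snd q) (\<Phi> (fst q))"
    \<comment> \<open>The block may change \<open>s\<close> only at the new positions, so only there
      are the values of \<open>q\<close> copied; below \<open>b\<close> the two agree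
      already.\<close>
    define t where "t v = (if v \<in> underS r (fst q) - underS r b then snd q v else s v)" for v
    have eq: "t v = snd q v" if "v \<in> underS r (fst q)" for v
      using that q(1) unfolding extends_def t_def by auto
    have "sat UNIV N t (\<Phi> (fst q))"
      using q(2) sat_cong[of "\<Phi> (fst q)" t "snd q"] eq fv[of "fst q"] by blast
    moreover have "inj_on t (underS r (fst q))"
      using q(1) by (subst inj_on_cong[OF eq]) (auto simp: extends_def)
    moreover have "\<forall>v. v \<notin> underS r (fst q) - underS r b \<longrightarrow> t v = s v" by (simp add: t_def)
    moreover have "\<not> (\<exists>t. (\<forall>v. v \<notin> underS r (fst q) - underS r b \<longrightarrow> t v = s v) \<and>
        inj_on t (underS r (fst q)) \<and> sat UNIV N t (\<Phi> (fst q)))"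
      using L q(1) by (simp add: no_ext_def And_simps extends_def)
    ultimately show False by blast
  qed
next
  assume R: "\<forall>q. extends (b, s) q \<longrightarrow> \<not> sat UNIV N (snd q) (\<Phi> (fst q))"
  show "sat UNIV N s (no_ext \<Phi> b)"
    unfolding no_ext_def sat.simps And_simps
  proof (intro ballI notI)
    fix c assume "c \<in> {c. (b, c) \<in> r}"
      and "\<exists>s'. (\<forall>v. v \<notin> underS r c - underS r b \<longrightarrow> s' v = s v) \<and>
        s' ` (underS r c - underS r b) \<subseteq> UNIV \<and>
        sat UNIV N s' (inj_fml (underS r c)) \<and> sat UNIV N s' (\<Phi> c)"
    then obtain t where "(b, c) \<in> r" "\<forall>v. v \<notin> underS r c - underS r b \<longrightarrow> t v = s v"
      "inj_on t (underS r c)" "sat UNIV N t (\<Phi> c)" by auto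
    then show False using R[rule_format, of "(c, t)"] unfolding extends_def by auto
  qed
qed

lemma no_ext_wf:
  assumes "\<And>c. wf_inf r ar (\<Phi> c)" "\<And>c. fv (\<Phi> c) \<subseteq> underS r c" "\<And>c. qr_le w (\<Phi> c)"
    and "Well_order w" "w <o w'"
  shows "wf_inf r ar (no_ext \<Phi> b)" "fv (no_ext \<Phi> b) \<subseteq> underS r b" "qr_le w' (no_ext \<Phi> b)"
proof -
  have "wf_inf r ar (And (inj_fml (underS r c)) (\<Phi> c))"
       "qr_le w (And (inj_fml (underS r c)) (\<Phi> c))" for c
    using assms(1,3) by (auto simp: And_def intro!: wf_inf.intros qr_le.intros)
  note * = this
  show "wf_inf r ar (no_ext \<Phi> b)"
    unfolding no_ext_def
    by (intro wf_inf.intros(3-5) ballI small_subset[OF small_underS Diff_subset] *)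
  show "qr_le w' (no_ext \<Phi> b)"
    unfolding no_ext_def by (intro qr_le.intros(3,4) ballI qr_le.intros(5)[OF assms(4,5)] *)
  show "fv (no_ext \<Phi> b) \<subseteq> underS r b"
    unfolding no_ext_def fv.simps And_simps
    by (rule UN_least) (use assms(2) inj_fml_simps(2) in fast)
qed

section \<open>Codes of copies and definable forcing\<close>

text \<open>A structure has many codes; fixing the one with values 0 and 1, and 0 at points that
  code no tuple, lets a generic copy determine a single point of the section.\<close>

definition code :: "(nat \<Rightarrow> 'k list \<Rightarrow> bool) \<Rightarrow> 'k \<Rightarrow> 'k" where
  "code N y = (if \<exists>m as. y = \<pi> (knat r m # as) \<and> length as = ar m \<and> N m as
     then knat r 1 else kzero r)"

lemma pi_eq_iff: "\<pi> (knat r m # as) = \<pi> (knat r m' # as') \<longleftrightarrow> m = m' \<and> as = as'"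
  using inj_pi inj_knat by (simp add: inj_eq)

lemma kzero_neq_one: "knat r 1 \<noteq> kzero r"
  using inj_knat knat.simps(1)[of r] by (metis injD zero_neq_one)

lemma code_struct_code:
  assumes "\<And>m as. N m as \<Longrightarrow> length as = ar m"
  shows "code_struct r ar \<pi> (code N) = N"
  using assms kzero_neq_one by (auto simp: fun_eq_iff code_struct_def code_def pi_eq_iff)

text \<open>The family \<open>\<Phi>\<close> defines the strong forcing relation for the section of \<open>A\<close> at \<open>\<eta>\<close>: the formula
  \<open>\<Phi> b\<close>, with the condition \<open>s\<close> of length \<open>b\<close> assigned to its variables, says in \<open>N\<close> that the copy of
  \<open>N\<close> along every sufficiently generic enumeration extending \<open>s\<close> has its code in the section.\<close>

definition forces :: "(('k \<Rightarrow> 'k) \<times> ('k \<Rightarrow> 'k)) set \<Rightarrow> ('k \<Rightarrow> 'k) \<Rightarrow> ('k \<times> 'k) set \<Rightarrow>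
    ('k \<Rightarrow> 'k fml) \<Rightarrow> bool" where
  "forces A \<eta> w \<Phi> \<longleftrightarrow>
     (\<forall>b. wf_inf r ar (\<Phi> b) \<and> fv (\<Phi> b) \<subseteq> underS r b \<and> qr_le w (\<Phi> b)) \<and>
     (\<forall>N p q. extends p q \<longrightarrow> sat UNIV N (snd p) (\<Phi> (fst p)) \<longrightarrow> sat UNIV N (snd q) (\<Phi> (fst q))) \<and>
     (\<forall>N. \<exists>\<D>. |\<D>| \<le>o |UNIV :: 'k set| \<and> (\<forall>D\<in>\<D>. dense D) \<and>
        (\<forall>h. bij h \<longrightarrow> (\<forall>D\<in>\<D>. meets h D) \<longrightarrow>
           ((\<eta>, code (\<lambda>m as. N m (map h as))) \<in> A \<longleftrightarrow> (\<exists>b. sat UNIV N h (\<Phi> b)))))"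

text \<open>The bound \<open>w\<close> comes before \<eta>. This uniformity is essential: the final
  argument picks \<eta> and \<eta>' only after the rank has been fixed.\<close>

definition forceable :: "(('k \<Rightarrow> 'k) \<times> ('k \<Rightarrow> 'k)) set \<Rightarrow> bool" where
  "forceable A \<longleftrightarrow> (\<exists>w. Well_order w \<and> (\<forall>\<eta>. \<exists>\<Phi>. forces A \<eta> w \<Phi>))"

lemma forces_mono: "forces A \<eta> w \<Phi> \<Longrightarrow> w \<le>o w' \<Longrightarrow> forces A \<eta> w' \<Phi>"
  unfolding forces_def using qr_le_mono by blast

lemma forces_Falsum:
  assumes "\<And>\<zeta>. (\<eta>, \<zeta>) \<notin> A"
  shows "forces A \<eta> w (\<lambda>_. Falsum)"
  unfolding forces_def using assms by (auto intro!: exI[of _ "{}"] card_of_empty)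

section \<open>Borel sets are forceable\<close>

text \<open>The family \<open>no_ext \<Phi>\<close> works at the price of one more quantifier block.
  The conditions deciding between \<open>\<Phi>\<close> and \<open>no_ext \<Phi>\<close> form a
  dense set \<open>E\<close>, which is added to the dense sets for \<open>A\<close>.\<close>

lemma forceable_compl:
  assumes "forceable A"
  shows "forceable (- A)"
proof -
  obtain w where w: "Well_order w" "\<And>\<eta>. \<exists>\<Phi>. forces A \<eta> w \<Phi>"
    using assms unfolding forceable_def by blast
  obtain w' :: "('k \<times> 'k) set" where w': "Well_order w'" "w <o w'"
    using ex_Well_order_greater[of UNIV "\<lambda>_. w"] w(1) by blast
  have "\<exists>\<Phi>'. forces (- A) \<eta> w' \<Phi>'" for \<eta>
  proof -
    obtain \<Phi> where \<Phi>: "forces A \<eta> w \<Phi>" using w(2) by blast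
    have wf: "\<And>c. wf_inf r ar (\<Phi> c)" "\<And>c. fv (\<Phi> c) \<subseteq> underS r c" "\<And>c. qr_le w (\<Phi> c)"
      using \<Phi> unfolding forces_def by auto
    have mono: "sat UNIV N (snd q) (\<Phi> (fst q))"
      if "extends p q" "sat UNIV N (snd p) (\<Phi> (fst p))" for N p q
      using \<Phi> that unfolding forces_def by blast
    note wf' = no_ext_wf[OF wf w(1) w'(2)]
    have sat: "sat UNIV N s (no_ext \<Phi> b) \<longleftrightarrow>
        (\<forall>q. extends (b, s) q \<longrightarrow> \<not> sat UNIV N (snd q) (\<Phi> (fst q)))" for N s b
      by (rule sat_no_ext[OF wf(2)])
    have "\<exists>\<D>. |\<D>| \<le>o |UNIV :: 'k set| \<and> (\<forall>D\<in>\<D>. dense D) \<and>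
        (\<forall>h. bij h \<longrightarrow> (\<forall>D\<in>\<D>. meets h D) \<longrightarrow>
           ((\<eta>, code (\<lambda>m as. N m (map h as))) \<in> - A \<longleftrightarrow> (\<exists>b. sat UNIV N h (no_ext \<Phi> b))))" for N
    proof -
      obtain \<D> where D: "|\<D>| \<le>o |UNIV :: 'k set|" "\<And>D. D \<in> \<D> \<Longrightarrow> dense D"
        "\<And>h. bij h \<Longrightarrow> (\<And>D. D \<in> \<D> \<Longrightarrow> meets h D) \<Longrightarrow>
           (\<eta>, code (\<lambda>m as. N m (map h as))) \<in> A \<longleftrightarrow> (\<exists>b. sat UNIV N h (\<Phi> b))"
        using \<Phi> unfolding forces_def by meson
      define E where "E = {q. sat UNIV N (snd q) (\<Phi> (fst q)) \<or> sat UNIV N (snd q) (no_ext \<Phi> (fst q))}"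
      have "dense E"
        unfolding dense_def
      proof (intro allI impI)
        fix p assume p: "extends p p"
        show "\<exists>q\<in>E. extends p q"
        proof (cases "\<exists>q. extends p q \<and> sat UNIV N (snd q) (\<Phi> (fst q))")
          case True
          then show ?thesis unfolding E_def by blast
        next
          case False
          then have "p \<in> E" unfolding E_def using sat[of N "snd p" "fst p"] by auto
          then show ?thesis using p by blast
        qed
      qed
      moreover have "|insert E \<D>| \<le>o |UNIV :: 'k set|"
      proof -
        have "|{E} \<union> \<D>| \<le>o |UNIV :: 'k set|"
          by (rule card_of_Un_ordLeq_infinite_Field[OF _ _ D(1) card_of_Card_order])
             (simp_all add: infinite_UNIV Field_card_of card_of_singl_ordLeq)
        then show ?thesis by simp
      qed
      moreover have "(\<eta>, code (\<lambda>m as. N m (map h as))) \<in> - A \<longleftrightarrow> (\<exists>b. sat UNIV N h (no_ext \<Phi> b))"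
        if h: "bij h" "meets h E" "\<And>D. D \<in> \<D> \<Longrightarrow> meets h D" for h
      proof -
        \<comment> \<open>All restrictions of \<open>h\<close> are compatible conditions, so
          \<open>\<Phi>\<close> at one length and \<open>no_ext \<Phi>\<close> at another contradict
          each other at the larger length.\<close>
        have ext: "extends (b, h) (c, h)" if "(b, c) \<in> r" for b c
          using that h(1) by (auto simp: extends_def intro: inj_on_subset[OF bij_is_inj])
        have "(\<exists>b. sat UNIV N h (\<Phi> b)) \<or> (\<exists>b. sat UNIV N h (no_ext \<Phi> b))"
        proof -
          obtain q where q: "q \<in> E" "\<And>i. i \<in> underS r (fst q) \<Longrightarrow> h i = snd q i"
            using h(2) unfolding meets_def by blast
          have "sat UNIV N h \<phi> = sat UNIV N (snd q) \<phi>" if "fv \<phi> \<subseteq> underS r (fst q)" for \<phi>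
            using sat_cong[of \<phi> h "snd q"] q(2) that by blast
          from this[OF wf(2)] this[OF wf'(2)] show ?thesis using q(1) unfolding E_def by blast
        qed
        moreover have False if "sat UNIV N h (\<Phi> b)" "sat UNIV N h (no_ext \<Phi> c)" for b c
        proof (cases "(b, c) \<in> r")
          case True
          then have "sat UNIV N h (\<Phi> c)" using mono[OF ext[OF True]] that(1) by simp
          then show False using that(2) ext[OF refl, of c] unfolding sat by fastforce
        next
          case False
          then have "extends (c, h) (b, h)" using total ext by blast
          then show False using that unfolding sat by fastforce
        qed
        ultimately show ?thesis using D(3)[OF h(1,3)] by blast
      qed
      ultimately show ?thesis using D(2) by (intro exI[of _ "insert E \<D>"]) auto
    qed
    moreover have "sat UNIV N (snd q) (no_ext \<Phi> (fst q))"
      if "extends p q" "sat UNIV N (snd p) (no_ext \<Phi> (fst p))" for N p q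
      using that extends_trans[OF that(1)] unfolding sat by simp
    ultimately have "forces (- A) \<eta> w' (no_ext \<Phi>)"
      using wf' unfolding forces_def by blast
    then show ?thesis by blast
  qed
  then show ?thesis using w'(1) unfolding forceable_def by blast
qed

text \<open>A union is forced by the disjunction of the families, written with \<open>Neg\<close>
  and \<open>Conj\<close>. The \<kappa> many collections of at most \<kappa> dense sets are united
  into one of size at most \<kappa>.\<close>

lemma forceable_UN:
  fixes I :: "'k set"
  assumes "\<And>i. i \<in> I \<Longrightarrow> forceable (B i)"
  shows "forceable (\<Union>i\<in>I. B i)"
proof -
  obtain w where w: "\<And>i. i \<in> I \<Longrightarrow> Well_order (w i)" "\<And>i \<eta>. i \<in> I \<Longrightarrow> \<exists>\<Phi>. forces (B i) \<eta> (w i) \<Phi>"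
    using assms unfolding forceable_def by metis
  obtain v :: "('k \<times> 'k) set" where v: "Well_order v" "\<And>i. i \<in> I \<Longrightarrow> w i <o v"
    using ex_Well_order_greater[of I w] w(1) by blast
  have "\<exists>\<Phi>. forces (\<Union>i\<in>I. B i) \<eta> v \<Phi>" for \<eta>
  proof -
    have "\<exists>\<Phi>. forces (B i) \<eta> v \<Phi>" if "i \<in> I" for i
      using w(2)[OF that] forces_mono ordLess_imp_ordLeq[OF v(2)[OF that]] by blast
    then obtain \<Phi> where \<Phi>: "\<And>i. i \<in> I \<Longrightarrow> forces (B i) \<eta> v (\<Phi> i)" by metis
    define \<Psi> where "\<Psi> b = Neg (Conj I (\<lambda>i. Neg (\<Phi> i b)))" for b
    have sat: "sat UNIV N s (\<Psi> b) \<longleftrightarrow> (\<exists>i\<in>I. sat UNIV N s (\<Phi> i b))" for N s b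
      by (simp add: \<Psi>_def)
    have "wf_inf r ar (\<Psi> b) \<and> fv (\<Psi> b) \<subseteq> underS r b \<and> qr_le v (\<Psi> b)" for b
    proof -
      have "wf_inf r ar (\<Phi> i b) \<and> fv (\<Phi> i b) \<subseteq> underS r b \<and> qr_le v (\<Phi> i b)" if "i \<in> I" for i
        using \<Phi>[OF that] unfolding forces_def by blast
      then show ?thesis
        unfolding \<Psi>_def by (auto intro!: wf_inf.intros qr_le.intros)
    qed
    moreover have "sat UNIV N (snd q) (\<Psi> (fst q))"
      if "extends p q" "sat UNIV N (snd p) (\<Psi> (fst p))" for N p q
      using that \<Phi> unfolding sat forces_def by blast
    moreover have "\<exists>\<D>. |\<D>| \<le>o |UNIV :: 'k set| \<and> (\<forall>D\<in>\<D>. dense D) \<and>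
        (\<forall>h. bij h \<longrightarrow> (\<forall>D\<in>\<D>. meets h D) \<longrightarrow>
           ((\<eta>, code (\<lambda>m as. N m (map h as))) \<in> (\<Union>i\<in>I. B i) \<longleftrightarrow> (\<exists>b. sat UNIV N h (\<Psi> b))))" for N
    proof -
      define good where "good i \<D> \<longleftrightarrow> |\<D>| \<le>o |UNIV :: 'k set| \<and> (\<forall>D\<in>\<D>. dense D) \<and>
        (\<forall>h. bij h \<longrightarrow> (\<forall>D\<in>\<D>. meets h D) \<longrightarrow>
           ((\<eta>, code (\<lambda>m as. N m (map h as))) \<in> B i \<longleftrightarrow> (\<exists>b. sat UNIV N h (\<Phi> i b))))" for i \<D>
      have "\<exists>\<D>. good i \<D>" if "i \<in> I" for i
        using \<Phi>[OF that] unfolding good_def forces_def by blast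
      then obtain \<D> where D: "\<And>i. i \<in> I \<Longrightarrow> good i (\<D> i)" by metis
      have "|\<Union>i\<in>I. \<D> i| \<le>o |UNIV :: 'k set|"
        using D by (intro card_of_UNION_ordLeq_infinite[OF infinite_UNIV]) (auto simp: good_def card_of_mono1)
      moreover have "(\<eta>, code (\<lambda>m as. N m (map h as))) \<in> (\<Union>i\<in>I. B i) \<longleftrightarrow> (\<exists>b. sat UNIV N h (\<Psi> b))"
        if h: "bij h" "\<forall>D\<in>(\<Union>i\<in>I. \<D> i). meets h D" for h
      proof -
        have "(\<eta>, code (\<lambda>m as. N m (map h as))) \<in> B i \<longleftrightarrow> (\<exists>b. sat UNIV N h (\<Phi> i b))" if "i \<in> I" for i
          using D[OF that] h that unfolding good_def by blast
        then show ?thesis unfolding sat by blast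
      qed
      moreover have "\<forall>D\<in>(\<Union>i\<in>I. \<D> i). dense D" using D unfolding good_def by blast
      ultimately show ?thesis by blast
    qed
    ultimately have "forces (\<Union>i\<in>I. B i) \<eta> v \<Psi>" unfolding forces_def by blast
    then show ?thesis by blast
  qed
  then show ?thesis using v(1) unfolding forceable_def by blast
qed

text \<open>It expresses that the condition of length \<open>b\<close> already decides the code of
  the copy to be \<open>g y\<close> at \<open>y\<close>. The entries of the tuple coded by
  \<open>y\<close> serve as variables, because the element \<open>a\<close> of the copy stands for
  the value of the enumeration at \<open>a\<close>. \<open>Falsum\<close> covers tuples not yet
  enumerated and values other than 0 and 1.\<close>

definition value_fml :: "('k \<Rightarrow> 'k) \<Rightarrow> 'k \<Rightarrow> 'k \<Rightarrow> 'k fml" where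
  "value_fml g b y =
     (if \<exists>m as. y = \<pi> (knat r m # as) \<and> length as = ar m then
        (let (m, as) = (SOME (m, as). y = \<pi> (knat r m # as) \<and> length as = ar m) in
         if \<not> set as \<subseteq> underS r b then Falsum
         else if g y = knat r 1 then Rel m as
         else if g y = kzero r then Neg (Rel m as) else Falsum)
      else if g y = kzero r then Neg Falsum else Falsum)"

lemma value_fml_code:
  assumes "length as = ar m"
  shows "value_fml g b (\<pi> (knat r m # as)) =
    (if \<not> set as \<subseteq> underS r b then Falsum
     else if g (\<pi> (knat r m # as)) = knat r 1 then Rel m as
     else if g (\<pi> (knat r m # as)) = kzero r then Neg (Rel m as) else Falsum)"
proof -
  have "(SOME (m', as'). \<pi> (knat r m # as) = \<pi> (knat r m' # as') \<and> length as' = ar m') = (m, as)"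
    by (rule some_equality) (use assms in \<open>auto simp: pi_eq_iff\<close>)
  then show ?thesis using assms unfolding value_fml_def by auto
qed

lemma value_fml_noncode:
  assumes "\<nexists>m as. y = \<pi> (knat r m # as) \<and> length as = ar m"
  shows "value_fml g b y = (if g y = kzero r then Neg Falsum else Falsum)"
  by (simp only: value_fml_def if_not_P[OF assms])

lemma value_fml_wf:
  "wf_inf r ar (value_fml g b y) \<and> fv (value_fml g b y) \<subseteq> underS r b \<and> qr_le w (value_fml g b y)"
proof (cases "\<exists>m as. y = \<pi> (knat r m # as) \<and> length as = ar m")
  case True
  then obtain m as where y: "y = \<pi> (knat r m # as)" "length as = ar m" by blast
  then show ?thesis
    unfolding y(1) value_fml_code[OF y(2)] by (auto intro: wf_inf.intros qr_le.intros)
qed (auto simp: value_fml_noncode intro: wf_inf.intros qr_le.intros)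

lemma value_fml_mono:
  assumes "extends p q" and "sat UNIV N (snd p) (value_fml g (fst p) y)"
  shows "sat UNIV N (snd q) (value_fml g (fst q) y)"
proof (cases "\<exists>m as. y = \<pi> (knat r m # as) \<and> length as = ar m")
  case True
  then obtain m as where y: "y = \<pi> (knat r m # as)" "length as = ar m" by blast
  have sub: "set as \<subseteq> underS r (fst p)"
    using assms(2) unfolding y(1) value_fml_code[OF y(2)] by (auto split: if_splits)
  have eq: "map (snd q) as = map (snd p) as" and "set as \<subseteq> underS r (fst q)"
    using sub assms(1) underS_mono unfolding extends_def by (auto simp: subset_iff)
  then show ?thesis
    using assms(2) sub unfolding y(1) value_fml_code[OF y(2)]
    by (auto split: if_splits simp: eq simp del: map_eq_conv)
qed (use assms(2) in \<open>simp add: value_fml_noncode split: if_splits\<close>)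

text \<open>A tuple is finite, so some \<open>b\<close> bounds its entries, and from that length on
  its atomic fact is decided.\<close>

lemma sat_value_fml:
  "\<exists>b. \<forall>c. (b, c) \<in> r \<longrightarrow>
     (sat UNIV N h (value_fml g c y) \<longleftrightarrow> code (\<lambda>m as. N m (map h as)) y = g y)"
proof (cases "\<exists>m as. y = \<pi> (knat r m # as) \<and> length as = ar m")
  case True
  then obtain m as where y: "y = \<pi> (knat r m # as)" "length as = ar m" by blast
  obtain b where b: "set as \<subseteq> underS r b" using small_bounded[OF small_finite] by blast
  have "code (\<lambda>m as. N m (map h as)) y = (if N m (map h as) then knat r 1 else kzero r)"
    using y by (auto simp: code_def pi_eq_iff)
  moreover have "set as \<subseteq> underS r c" if "(b, c) \<in> r" for c
    using b underS_mono[OF that] by blast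
  ultimately show ?thesis
    using kzero_neq_one unfolding y(1) value_fml_code[OF y(2)]
    by (intro exI[of _ b]) auto
next
  case False
  then have "code (\<lambda>m as. N m (map h as)) y = kzero r" by (auto simp: code_def)
  then show ?thesis by (auto simp: value_fml_noncode[OF False])
qed

text \<open>As \<open>Y\<close> is small, regularity gives one length at which all values on
  \<open>Y\<close> are decided. This works along every bijection, so the family of dense sets is
  empty. If \<eta> lies outside the first factor, the section is empty.\<close>

lemma forceable_basic:
  assumes "small r Y"
  shows "forceable (basic_nbhd X f \<times> basic_nbhd Y g)"
proof -
  have "\<exists>\<Phi>. forces (basic_nbhd X f \<times> basic_nbhd Y g) \<eta> r \<Phi>" for \<eta>
  proof (cases "\<eta> \<in> basic_nbhd X f")
    case True
    define \<Phi> where "\<Phi> b = Conj Y (value_fml g b)" for b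
    have "wf_inf r ar (\<Phi> b) \<and> fv (\<Phi> b) \<subseteq> underS r b \<and> qr_le r (\<Phi> b)" for b
      using value_fml_wf[of g b] unfolding \<Phi>_def
      by (auto intro!: wf_inf.intros qr_le.intros simp: subset_iff)
    moreover have "sat UNIV N (snd q) (\<Phi> (fst q))"
      if "extends p q" "sat UNIV N (snd p) (\<Phi> (fst p))" for N p q
      using value_fml_mono[OF that(1)] that(2) unfolding \<Phi>_def by simp
    moreover have "(\<eta>, code (\<lambda>m as. N m (map h as))) \<in> basic_nbhd X f \<times> basic_nbhd Y g \<longleftrightarrow>
        (\<exists>b. sat UNIV N h (\<Phi> b))" if "bij h" for N h
    proof -
      let ?P = "\<lambda>y b. \<forall>c. (b, c) \<in> r \<longrightarrow>
        (sat UNIV N h (value_fml g c y) \<longleftrightarrow> code (\<lambda>m as. N m (map h as)) y = g y)"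
      have "\<forall>y. \<exists>b. ?P y b" using sat_value_fml by blast
      then obtain \<beta> where \<beta>: "\<And>y. ?P y (\<beta> y)" by metis
      obtain b where b: "\<beta> ` Y \<subseteq> underS r b"
        using small_bounded[OF small_image[OF assms]] by blast
      have val: "sat UNIV N h (value_fml g b y) \<longleftrightarrow> code (\<lambda>m as. N m (map h as)) y = g y"
        if "y \<in> Y" for y
        using \<beta>[of y] that b by (auto simp: underS_def)
      have "sat UNIV N h (\<Phi> b)" if "sat UNIV N h (\<Phi> c)" for c
      proof -
        \<comment> \<open>Truth at \<open>c\<close> passes up to a common longer length
          \<open>d\<close>, where the formulas give the true values of the code; these are then read
          off at \<open>b\<close>.\<close>
        obtain d where d: "{b, c} \<subseteq> underS r d"
          using small_bounded[OF small_finite[of "{b, c}"]] by auto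
        have "extends (c, h) (d, h)"
          using d \<open>bij h\<close> by (auto simp: extends_def underS_def intro: inj_on_subset[OF bij_is_inj])
        then have "sat UNIV N h (value_fml g d y)" if "y \<in> Y" for y
          using value_fml_mono[of "(c, h)" "(d, h)"] \<open>sat UNIV N h (\<Phi> c)\<close> that by (simp add: \<Phi>_def)
        moreover have "(\<beta> y, d) \<in> r" if "y \<in> Y" for y
          using b d that trans[of "\<beta> y" b d] by (auto simp: underS_def)
        ultimately have "code (\<lambda>m as. N m (map h as)) y = g y" if "y \<in> Y" for y
          using \<beta> that by blast
        then show ?thesis using val by (simp add: \<Phi>_def)
      qed
      then have "(\<exists>b. sat UNIV N h (\<Phi> b)) \<longleftrightarrow> sat UNIV N h (\<Phi> b)" by blast
      then show ?thesis using True val by (auto simp: \<Phi>_def basic_nbhd_def)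
    qed
    ultimately have "forces (basic_nbhd X f \<times> basic_nbhd Y g) \<eta> r \<Phi>"
      unfolding forces_def by (intro conjI allI impI exI[of _ "{}"]) (auto simp: card_of_empty)
    then show ?thesis by blast
  next
    case False
    then show ?thesis using forces_Falsum[of \<eta>] by blast
  qed
  then show ?thesis using Well_order unfolding forceable_def by blast
qed

lemma kborel2_forceable: "A \<in> kborel2 r \<Longrightarrow> forceable A"
proof (induction rule: kborel2.induct)
  case empty
  then show ?case using Well_order forces_Falsum[of _ "{}"] unfolding forceable_def by blast
next
  case (basic X Y g h)
  then show ?case by (simp add: forceable_basic)
next
  case (compl A)
  then show ?case by (simp add: forceable_compl)
next
  case (union I B)
  then show ?case by (simp add: forceable_UN)
next
  case (inter I B)
  then have "forceable (- (\<Union>i\<in>I. - B i))"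
    by (intro forceable_compl forceable_UN) blast
  moreover have "- (\<Union>i\<in>I. - B i) = (\<Inter>i\<in>I. B i)" by blast
  ultimately show ?case by simp
qed

end

section \<open>Transfer of the forcing sentence from \<eta> to \<eta>'\<close>

theorem theorem4p4:
  fixes r :: "('k \<times> 'k) set" and ar :: "nat \<Rightarrow> nat"
    and \<pi> :: "'k list \<Rightarrow> 'k" and T :: "'k fml set"
  assumes "regular_infinite_cardinal r"
    and "bij \<pi>"
    and "complete_countable_theory ar T"
    and "\<forall>w :: ('k \<times> 'k) set. Well_order w \<longrightarrow>
           (\<exists>\<eta> \<eta>'. models_theory UNIV (code_struct r ar \<pi> \<eta>) T
                 \<and> models_theory UNIV (code_struct r ar \<pi> \<eta>') T
                 \<and> equiv_upto r ar w (code_struct r ar \<pi> \<eta>) (code_struct r ar \<pi> \<eta>')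
                 \<and> \<not> struct_iso (code_struct r ar \<pi> \<eta>) (code_struct r ar \<pi> \<eta>'))"
  shows "iso_T r ar \<pi> T \<notin> kborel2 r"
proof
  assume borel: "iso_T r ar \<pi> T \<in> kborel2 r"
  interpret kappa_coding r ar \<pi>
    using assms(1,2) by (simp add: kappa_coding_def bij_is_inj)
  let ?A = "iso_T r ar \<pi> T" and ?S = "code_struct r ar \<pi>"
  have "forceable (- ?A)" using borel by (intro kborel2_forceable kborel2.compl)
  then obtain w where w: "Well_order w" "\<And>\<eta>. \<exists>\<Phi>. forces (- ?A) \<eta> w \<Phi>"
    unfolding forceable_def by blast
  \<comment> \<open>Strictly above \<open>w\<close>, to leave room for the quantifier block in
    \<open>no_ext\<close>.\<close>
  obtain w' :: "('k \<times> 'k) set" where w': "Well_order w'" "w <o w'"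
    using ex_Well_order_greater[of UNIV "\<lambda>_. w"] w(1) by blast
  obtain \<eta> \<eta>' where models: "models_theory UNIV (?S \<eta>) T" "models_theory UNIV (?S \<eta>') T"
    and equiv: "equiv_upto r ar w' (?S \<eta>) (?S \<eta>')" and noniso: "\<not> struct_iso (?S \<eta>) (?S \<eta>')"
    using assms(4) w'(1) by blast
  obtain \<Phi> where \<Phi>: "forces (- ?A) \<eta> w \<Phi>" using w(2) by blast
  have wf: "\<And>c. wf_inf r ar (\<Phi> c)" "\<And>c. fv (\<Phi> c) \<subseteq> underS r c" "\<And>c. qr_le w (\<Phi> c)"
    using \<Phi> unfolding forces_def by auto
  note wf' = no_ext_wf[OF wf w(1) w'(2), of "kzero r"]
  have generic: "\<exists>h. bij h \<and> (\<forall>i\<in>underS r (fst p). h i = snd p i) \<and>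
      ((\<eta>, code (\<lambda>m as. N m (map h as))) \<in> - ?A \<longleftrightarrow> (\<exists>b. sat UNIV N h (\<Phi> b)))"
    if "extends p p" for N p
  proof -
    obtain \<D> where D: "|\<D>| \<le>o |UNIV :: 'k set|" "\<forall>D\<in>\<D>. dense D"
        "\<forall>h. bij h \<longrightarrow> (\<forall>D\<in>\<D>. meets h D) \<longrightarrow>
           ((\<eta>, code (\<lambda>m as. N m (map h as))) \<in> - ?A \<longleftrightarrow> (\<exists>b. sat UNIV N h (\<Phi> b)))"
      using \<Phi> unfolding forces_def by meson
    then show ?thesis using ex_generic_bij[OF D(1) _ that] by blast
  qed
  have code_copy: "?S (code (\<lambda>m as. ?S \<xi> m (map h as))) = (\<lambda>m as. ?S \<xi> m (map h as))" for \<xi> h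
    by (rule code_struct_code) (simp add: code_struct_def)
  \<comment> \<open>At length 0 every condition is an extension, so
    \<open>no_ext \<Phi> (kzero r)\<close> is a sentence about all conditions.\<close>
  have ext: "extends (kzero r, s) q \<longleftrightarrow> extends q q" for s q
    by (auto simp: extends_def underS_kzero kzero_le refl)
  have sent: "sentence_true UNIV N (no_ext \<Phi> (kzero r)) \<longleftrightarrow>
      (\<forall>q. extends q q \<longrightarrow> \<not> sat UNIV N (snd q) (\<Phi> (fst q)))" for N
    unfolding sentence_true_def sat_no_ext[OF wf(2)] ext by auto
  \<comment> \<open>A condition satisfying \<open>\<Phi>\<close> would lie on a generic
    \<open>h\<close> whose copy of the structure of \<eta> is not isomorphic to it, which is
    absurd.\<close>
  have "sentence_true UNIV (?S \<eta>) (no_ext \<Phi> (kzero r))"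
    unfolding sent
  proof (intro allI impI notI)
    fix q assume q: "extends q q" "sat UNIV (?S \<eta>) (snd q) (\<Phi> (fst q))"
    obtain h where h: "bij h" "\<forall>i\<in>underS r (fst q). h i = snd q i"
      "(\<eta>, code (\<lambda>m as. ?S \<eta> m (map h as))) \<in> - ?A \<longleftrightarrow> (\<exists>b. sat UNIV (?S \<eta>) h (\<Phi> b))"
      using generic[OF q(1)] by blast
    have "sat UNIV (?S \<eta>) h (\<Phi> (fst q))"
      using q(2) h(2) wf(2)[of "fst q"] sat_cong[of "\<Phi> (fst q)" h "snd q"] by blast
    then have "(\<eta>, code (\<lambda>m as. ?S \<eta> m (map h as))) \<notin> ?A" using h(3) by blast
    moreover have "struct_iso (?S \<eta>) (\<lambda>m as. ?S \<eta> m (map h as))"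
      unfolding struct_iso_def using h(1)
      by (intro exI[of _ "inv h"]) (simp add: bij_imp_bij_inv comp_def bij_is_surj surj_f_inv_f)
    ultimately show False
      using models(1) models_theory_bij[OF h(1) models(1)] by (simp add: iso_T_def code_copy)
  qed
  then have "sentence_true UNIV (?S \<eta>') (no_ext \<Phi> (kzero r))"
    using equiv wf' underS_kzero unfolding equiv_upto_def by auto
  then have none: "\<not> sat UNIV (?S \<eta>') (snd q) (\<Phi> (fst q))" if "extends q q" for q
    using that unfolding sent by blast
  \<comment> \<open>The generic bijection for \<eta>' starts from the empty condition;
    \<open>id\<close> only fills irrelevant positions.\<close>
  have "extends (kzero r, id) (kzero r, id)" by (simp add: extends_def refl)
  then obtain h where h: "bij h"
      "(\<eta>, code (\<lambda>m as. ?S \<eta>' m (map h as))) \<in> - ?A \<longleftrightarrow> (\<exists>b. sat UNIV (?S \<eta>') h (\<Phi> b))"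
    using generic by blast
  have "\<not> sat UNIV (?S \<eta>') h (\<Phi> b)" for b
    \<comment> \<open>Each restriction of the injective \<open>h\<close> is itself a condition, so
      no length makes \<open>\<Phi>\<close> true along \<open>h\<close>, and the code of the copy
      falls into the isomorphism relation.\<close>
    using none[of "(b, h)"] h(1) by (auto simp: extends_def refl intro: inj_on_subset[OF bij_is_inj])
  then have "(\<eta>, code (\<lambda>m as. ?S \<eta>' m (map h as))) \<in> ?A" using h(2) by blast
  then have "struct_iso (?S \<eta>) (\<lambda>m as. ?S \<eta>' m (map h as))"
    using models(1) by (simp add: iso_T_def code_copy)
  moreover have "struct_iso (\<lambda>m as. ?S \<eta>' m (map h as)) (?S \<eta>')"
    using h(1) unfolding struct_iso_def by blast
  ultimately show False using noniso struct_iso_trans by blast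
qed

end
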